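(* Let $1\le p<\infty$. The sequence spaces $\ell_p^{\lambda}(\widehat F)$ and $\ell_\infty^{\lambda}(\widehat F)$ are $BK$-spaces with the norms $$\|x\|_{\ell_p^{\lambda}(\widehat F)}=\|Ex\|_p=\Big(\sum_{n=0}^\infty |E_n(x)|^p\Big)^{1/p},\qquad \|x\|_{\ell_\infty^{\lambda}(\widehat F)}=\|Ex\|_\infty=\sup_{n\in\mathbb N_0}|E_n(x)|,$$ respectively.
   Context: $\mathbb N_0=\{0,1,2,\dots\}$; $\omega$ is the space of all real sequences $x=(x_k)_{k\in\mathbb N_0}$. Fibonacci numbers: $f_0=f_1=1$, $f_n=f_{n-1}+f_{n-2}$ for $n\ge 2$. $\lambda=(\lambda_k)_{k\in\mathbb N_0}$ is a fixed strictly increasing sequence of positive reals with $\lambda_k\to\infty$. Terms with negative subscript are $0$ (so $\lambda_{-1}=0$, $x_{-1}=0$). For $x\in\omega$ put $$E_n(x)=\frac1{\lambda_n}\sum_{k=0}^n(\lambda_k-\lambda_{k-1})\Big(\frac{f_k}{f_{k+1}}x_k-\frac{f_{k+1}}{f_k}x_{k-1}\Big),\qquad Ex=(E_n(x))_{n\in\mathbb N_0}.$$ Then $\ell_p^{\lambda}(\widehat F)=\{x\in\omega: Ex\in\ell_p\}$ for $1\le p<\infty$ and $\ell_\infty^{\lambda}(\widehat F)=\{x\in\omega: Ex\in\ell_\infty\}$. A $BK$-space is a linear subspace of $\omega$ with a norm making it a Banach space such that each coordinate map $x\mapsto x_n$ is continuous. *)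

theory Defs
  imports
    "HOL-Analysis.Analysis"
    "HOL-Library.Function_Algebras"
    "HOL-Number_Theory.Fib"
begin

subsection \<open>BK-spaces\<close>

text \<open>The space of all real sequences is the type \<^typ>\<open>nat \<Rightarrow> real\<close>. Its pointwise addition
  comes from \<^theory>\<open>HOL-Library.Function_Algebras\<close>; there is no \<^class>\<open>real_vector\<close>
  instance for it, so scalar multiplication is given explicitly.\<close>

definition seq_scale :: "real \<Rightarrow> (nat \<Rightarrow> real) \<Rightarrow> nat \<Rightarrow> real" where
  "seq_scale c x = (\<lambda>k. c * x k)"

interpretation seq: vector_space seq_scale
  by standard (simp_all add: seq_scale_def fun_eq_iff distrib_left distrib_right)

definition is_norm_on :: "(nat \<Rightarrow> real) set \<Rightarrow> ((nat \<Rightarrow> real) \<Rightarrow> real) \<Rightarrow> bool" where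
  "is_norm_on X N \<longleftrightarrow>
     (\<forall>x\<in>X. 0 \<le> N x) \<and>
     (\<forall>x\<in>X. N x = 0 \<longleftrightarrow> x = 0) \<and>
     (\<forall>c. \<forall>x\<in>X. N (seq_scale c x) = \<bar>c\<bar> * N x) \<and>
     (\<forall>x\<in>X. \<forall>y\<in>X. N (x + y) \<le> N x + N y)"

text \<open>The metric induced by a norm \<open>N\<close> on \<open>X\<close>. Since \<^locale>\<open>Metric_space\<close> demands a distance
  that is nonnegative and symmetric on the whole type, it is set to \<open>0\<close> off \<open>X\<close>, where
  \<open>N\<close> is unconstrained.\<close>

definition norm_dist ::
  "(nat \<Rightarrow> real) set \<Rightarrow> ((nat \<Rightarrow> real) \<Rightarrow> real) \<Rightarrow> (nat \<Rightarrow> real) \<Rightarrow> (nat \<Rightarrow> real) \<Rightarrow> real" where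
  "norm_dist X N x y = (if x \<in> X \<and> y \<in> X then N (x - y) else 0)"

definition BK_space :: "(nat \<Rightarrow> real) set \<Rightarrow> ((nat \<Rightarrow> real) \<Rightarrow> real) \<Rightarrow> bool" where
  "BK_space X N \<longleftrightarrow>
     seq.subspace X \<and>
     is_norm_on X N \<and>
     Metric_space.mcomplete X (norm_dist X N) \<and>
     (\<forall>n. continuous_map (Metric_space.mtopology X (norm_dist X N)) euclideanreal (\<lambda>x. x n))"

lemma Metric_space_norm_dist:
  assumes "seq.subspace X" "is_norm_on X N"
  shows "Metric_space X (norm_dist X N)"
proof
  have diff: "x - y \<in> X" if "x \<in> X" "y \<in> X" for x y
    using assms(1) that by (rule seq.subspace_diff)
  have N_nonneg: "\<forall>x\<in>X. 0 \<le> N x"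
    and N_zero: "\<forall>x\<in>X. N x = 0 \<longleftrightarrow> x = 0"
    and N_scale: "\<forall>c. \<forall>x\<in>X. N (seq_scale c x) = \<bar>c\<bar> * N x"
    and N_triangle: "\<forall>x\<in>X. \<forall>y\<in>X. N (x + y) \<le> N x + N y"
    using assms(2) unfolding is_norm_on_def by - (elim conjE, assumption)+
  fix x y z
  show "0 \<le> norm_dist X N x y"
    unfolding norm_dist_def using N_nonneg[rule_format, OF diff[of x y]] by simp
  have "N (x - y) = N (y - x)" if "x \<in> X" "y \<in> X"
  proof -
    have "seq_scale (-1) (y - x) = x - y"
      by (rule ext) (simp add: seq_scale_def)
    then show ?thesis
      using N_scale[rule_format, OF diff[OF that(2,1)], of "-1"] by simp
  qed
  then show "norm_dist X N x y = norm_dist X N y x"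
    unfolding norm_dist_def by simp
  show "norm_dist X N x y = 0 \<longleftrightarrow> x = y" if "x \<in> X" "y \<in> X"
    using N_zero[rule_format, OF diff[OF that]] that by (simp add: norm_dist_def)
  show "norm_dist X N x z \<le> norm_dist X N x y + norm_dist X N y z"
    if "x \<in> X" "y \<in> X" "z \<in> X"
  proof -
    have "x - z = (x - y) + (y - z)"
      by (rule ext) simp
    then show ?thesis
      using N_triangle[rule_format, OF diff[OF that(1,2)] diff[OF that(2,3)]] that
      by (simp only: norm_dist_def simp_thms if_True)
  qed
qed

subsection \<open>The classical spaces of p-summable and of bounded sequences\<close>

definition ell :: "real \<Rightarrow> (nat \<Rightarrow> real) set" where
  "ell p = {y. summable (\<lambda>n. \<bar>y n\<bar> powr p)}"

definition ell_norm :: "real \<Rightarrow> (nat \<Rightarrow> real) \<Rightarrow> real" where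
  "ell_norm p y = (\<Sum>n. \<bar>y n\<bar> powr p) powr (1 / p)"

definition ell_inf :: "(nat \<Rightarrow> real) set" where
  "ell_inf = {y. bounded (range y)}"

definition ell_inf_norm :: "(nat \<Rightarrow> real) \<Rightarrow> real" where
  "ell_inf_norm y = (SUP n. \<bar>y n\<bar>)"

subsection \<open>The lambda-Fibonacci difference spaces\<close>

text \<open>Fibonacci numbers indexed so that \<open>f\<^sub>0 = f\<^sub>1 = 1\<close>, whereas the library has \<open>fib 0 = 0\<close>.\<close>

definition fibF :: "nat \<Rightarrow> real" where
  "fibF n = real (fib (Suc n))"

lemma fibF_rec: "fibF 0 = 1" "fibF 1 = 1" "n \<ge> 2 \<Longrightarrow> fibF n = fibF (n - 1) + fibF (n - 2)"
proof -
  show "fibF n = fibF (n - 1) + fibF (n - 2)" if "n \<ge> 2"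
  proof -
    obtain m where "n = Suc (Suc m)"
      using \<open>n \<ge> 2\<close> by (cases n rule: fib.cases) auto
    then show ?thesis by (simp add: fibF_def)
  qed
qed (simp_all add: fibF_def)

text \<open>\<open>prev a k\<close> is \<open>a\<^sub>k\<^sub>-\<^sub>1\<close> under the convention that terms with negative subscript vanish.\<close>

definition prev :: "(nat \<Rightarrow> real) \<Rightarrow> nat \<Rightarrow> real" where
  "prev a k = (if k = 0 then 0 else a (k - 1))"

definition E :: "(nat \<Rightarrow> real) \<Rightarrow> (nat \<Rightarrow> real) \<Rightarrow> nat \<Rightarrow> real" where
  "E lam x n = 1 / lam n *
     (\<Sum>k=0..n. (lam k - prev lam k) *
        (fibF k / fibF (k + 1) * x k - fibF (k + 1) / fibF k * prev x k))"

definition ell_lamF :: "real \<Rightarrow> (nat \<Rightarrow> real) \<Rightarrow> (nat \<Rightarrow> real) set" where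
  "ell_lamF p lam = {x. E lam x \<in> ell p}"

definition ell_inf_lamF :: "(nat \<Rightarrow> real) \<Rightarrow> (nat \<Rightarrow> real) set" where
  "ell_inf_lamF lam = {x. E lam x \<in> ell_inf}"

end

theory Submission
  imports Defs
begin

text \<open>\<open>E\<close> is a lower triangular matrix with nonzero diagonal, hence a linear bijection of the space
  of all sequences, whose inverse is again lower triangular. The domain of such a matrix in a
  BK-space is isometric to that space, and its coordinates are finite linear combinations of the
  coordinates of the image, so it is a BK-space. The classical spaces are BK-spaces because their
  norms dominate the coordinates and their balls are closed under pointwise limits.\<close>

section \<open>A sufficient criterion for BK-spaces\<close>

lemma BK_space_Metric_space:
  assumes "BK_space X N"
  shows "Metric_space X (norm_dist X N)"
  using assms by (simp add: BK_space_def Metric_space_norm_dist)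

lemma seq_subspace_iff:
  "seq.subspace X \<longleftrightarrow>
     0 \<in> X \<and> (\<forall>x\<in>X. \<forall>y\<in>X. x + y \<in> X) \<and> (\<forall>c. \<forall>x\<in>X. seq_scale c x \<in> X)"
  by (auto simp: seq.subspace_def)

text \<open>Since \<open>N\<close> dominates the coordinates, a Cauchy sequence converges pointwise.
  Its differences eventually lie in a small ball, and \<open>closed\<close> keeps their pointwise
  limits in that ball, so the convergence is also in \<open>N\<close>. The same domination gives
  definiteness of \<open>N\<close> and continuity of the coordinates.\<close>

lemma BK_spaceI_closed_balls:
  assumes zero: "0 \<in> X"
    and add: "\<And>x y. x \<in> X \<Longrightarrow> y \<in> X \<Longrightarrow> x + y \<in> X \<and> N (x + y) \<le> N x + N y"
    and scale: "\<And>c x. x \<in> X \<Longrightarrow> seq_scale c x \<in> X \<and> N (seq_scale c x) \<le> \<bar>c\<bar> * N x"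
    and coord: "\<And>x k. x \<in> X \<Longrightarrow> \<bar>x k\<bar> \<le> N x"
    and closed: "\<And>z x r. (\<And>n::nat. z n \<in> X \<and> N (z n) \<le> r) \<Longrightarrow>
      (\<And>k. (\<lambda>n. z n k) \<longlonglongrightarrow> x k) \<Longrightarrow> x \<in> X \<and> N x \<le> r"
  shows "BK_space X N"
proof -
  have sub: "seq.subspace X"
    using zero add scale by (simp add: seq_subspace_iff)
  have nonneg: "0 \<le> N x" if "x \<in> X" for x
    using coord[OF that, of 0] by linarith
  have N0: "N 0 = 0"
    using scale[OF zero, of 0] nonneg[OF zero] by simp
  have N_eq_0: "N x = 0 \<longleftrightarrow> x = 0" if "x \<in> X" for x
  proof
    assume "N x = 0"
    then have "x k = 0" for k using coord[OF that, of k] by simp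
    then show "x = 0" by (simp add: fun_eq_iff)
  qed (simp add: N0)
  have N_scale: "N (seq_scale c x) = \<bar>c\<bar> * N x" if "x \<in> X" for c x
  proof (cases "c = 0")
    case True
    then show ?thesis using N0 by simp
  next
    case False
    \<comment> \<open>Scaling back by \<open>1 / c\<close> turns the assumed upper bound into the
      missing lower bound.\<close>
    have "seq_scale (1 / c) (seq_scale c x) = x"
      using False by simp
    then have "N x \<le> \<bar>1 / c\<bar> * N (seq_scale c x)"
      using scale[of "seq_scale c x" "1 / c"] scale[OF that, of c] by simp
    then have "\<bar>c\<bar> * N x \<le> N (seq_scale c x)"
      using False by (simp add: field_simps)
    then show ?thesis using scale[OF that, of c] by simp
  qed
  have norm: "is_norm_on X N"
    unfolding is_norm_on_def using nonneg N_eq_0 N_scale add by blast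
  interpret Metric_space X "norm_dist X N"
    using sub norm by (rule Metric_space_norm_dist)
  have diff: "x - y \<in> X" if "x \<in> X" "y \<in> X" for x y
    using sub that by (rule seq.subspace_diff)
  have "mcomplete"
    unfolding mcomplete_def
  proof (intro allI impI)
    fix s assume s: "MCauchy s"
    then have sX: "s n \<in> X" for n by (auto simp: MCauchy_def)
    have dist_s: "norm_dist X N (s m) (s n) = N (s m - s n)" for m n
      by (simp add: norm_dist_def sX)
    have "\<forall>e>0. \<exists>K. \<forall>m n. K \<le> m \<longrightarrow> K \<le> n \<longrightarrow> N (s m - s n) < e"
      using s unfolding MCauchy_def dist_s by (rule conjunct2)
    then have Cau: "\<exists>K. \<forall>m\<ge>K. \<forall>n\<ge>K. N (s m - s n) < e" if "e > 0" for e
      using that by metis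
    have "Cauchy (\<lambda>n. s n k)" for k
      unfolding Cauchy_def
    proof (intro allI impI)
      fix e :: real assume "e > 0"
      then obtain K where K: "\<forall>m\<ge>K. \<forall>n\<ge>K. N (s m - s n) < e" using Cau by blast
      have "dist (s m k) (s n k) < e" if "m \<ge> K" "n \<ge> K" for m n
        using coord[OF diff[OF sX sX], of m n k] K that by (force simp: dist_real_def)
      then show "\<exists>K. \<forall>m\<ge>K. \<forall>n\<ge>K. dist (s m k) (s n k) < e" by blast
    qed
    then have "\<exists>l. (\<lambda>n. s n k) \<longlonglongrightarrow> l" for k
      by (simp add: real_Cauchy_convergent convergentD)
    then obtain x where x: "\<And>k. (\<lambda>n. s n k) \<longlonglongrightarrow> x k" by metis
    have tail: "\<exists>K. \<forall>m\<ge>K. s m - x \<in> X \<and> N (s m - x) \<le> e" if "e > 0" for e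
    proof -
      from Cau[OF that] obtain K where K: "\<forall>m\<ge>K. \<forall>n\<ge>K. N (s m - s n) < e" by blast
      have "s m - x \<in> X \<and> N (s m - x) \<le> e" if "m \<ge> K" for m
      proof (rule closed)
        \<comment> \<open>The shift by \<open>K\<close> makes the bound hold for every
          \<open>n\<close>, as \<open>closed\<close> demands.\<close>
        show "s m - s (n + K) \<in> X \<and> N (s m - s (n + K)) \<le> e" for n
          using K that diff[OF sX sX] by (simp add: less_imp_le)
        show "(\<lambda>n. (s m - s (n + K)) k) \<longlonglongrightarrow> (s m - x) k" for k
          using LIMSEQ_ignore_initial_segment[OF x, of K k]
          by (auto intro: tendsto_diff)
      qed
      then show ?thesis by blast
    qed
    obtain m where "s m - x \<in> X" using tail[of 1] by auto
    \<comment> \<open>So far only differences with \<open>x\<close> are known to lie in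
      \<open>X\<close>; subtracting one from \<open>s m\<close> recovers \<open>x\<close>
      itself.\<close>
    then have "s m - (s m - x) \<in> X" using sX by (rule diff[rotated])
    then have xX: "x \<in> X" by simp
    have "\<exists>K. \<forall>n\<ge>K. s n \<in> X \<and> norm_dist X N (s n) x < e" if "e > 0" for e
    proof -
      \<comment> \<open>Halving \<open>e\<close> restores the strict inequality, which is lost in
        the limit.\<close>
      from that tail[of "e / 2"] obtain K where "\<forall>m\<ge>K. s m - x \<in> X \<and> N (s m - x) \<le> e / 2"
        by auto
      then have "\<forall>n\<ge>K. s n \<in> X \<and> norm_dist X N (s n) x < e"
        using that by (force simp: norm_dist_def sX xX)
      then show ?thesis ..
    qed
    then show "\<exists>l. limitin mtopology s l sequentially"
      using xX unfolding limit_metric_sequentially by blast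
  qed
  moreover have "continuous_map mtopology euclideanreal (\<lambda>x. x k)" for k
  proof -
    have "\<exists>\<delta>>0. \<forall>x. x \<in> X \<and> norm_dist X N a x < \<delta> \<longrightarrow> dist (a k) (x k) < e"
      if "a \<in> X" "e > 0" for a e
    proof (intro exI[of _ e] conjI allI impI)
      fix x assume x: "x \<in> X \<and> norm_dist X N a x < e"
      then have "\<bar>(a - x) k\<bar> < e"
        using coord[OF diff[of a x], of k] that by (force simp: norm_dist_def)
      then show "dist (a k) (x k) < e" by (simp add: dist_real_def)
    qed (rule that)
    then show ?thesis
      using metric_continuous_map[OF Met_TC.Metric_space_axioms, of "\<lambda>x. x k"] by simp
  qed
  ultimately show ?thesis
    unfolding BK_space_def using sub norm by blast
qed

subsection \<open>The classical spaces\<close>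

text \<open>On the open half-line this is \<open>powr_convex\<close>. If one point is 0, the claim
  reduces to \<open>s powr p \<le> s\<close> for \<open>s\<close> between 0 and 1, which uses
  \<open>1 \<le> p\<close>. The endpoint matters because coordinates of a sequence may
  vanish.\<close>

lemma powr_convex_nonneg:
  fixes p :: real
  assumes "1 \<le> p"
  shows "convex_on {0..} (\<lambda>x. x powr p)"
proof (rule convex_onI)
  fix t x y :: real
  assume t: "0 < t" "t < 1" and xy: "x \<in> {0..}" "y \<in> {0..}"
  have scale: "(s * z) powr p \<le> s * z powr p" if "0 < s" "s < 1" "0 \<le> z" for s z
  proof -
    have "s powr p \<le> s" using that assms by (intro powr_le_one_le) auto
    then have "s powr p * z powr p \<le> s * z powr p" by (intro mult_right_mono) auto
    then show ?thesis using that by (simp add: powr_mult)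
  qed
  consider "x = 0" | "y = 0" | "0 < x" "0 < y" using xy by fastforce
  then show "((1 - t) *\<^sub>R x + t *\<^sub>R y) powr p \<le> (1 - t) * x powr p + t * y powr p"
  proof cases
    case 3
    then show ?thesis using convex_onD[OF powr_convex[OF assms], of t x y] t by simp
  qed (use scale[of t y] scale[of "1 - t" x] t xy in auto)
qed simp

lemma ell_norm_nonneg: "0 \<le> ell_norm p y"
  by (simp add: ell_norm_def)

text \<open>The terms are nonnegative, so a bound on all partial sums gives both summability and a
  bound on the series. This describes the balls of \<open>ell p\<close> by finite sums only, which
  is how the triangle inequality, homogeneity and closedness are checked below.\<close>

lemma ell_norm_le_iff:
  assumes "0 < p" "0 \<le> r"
  shows "y \<in> ell p \<and> ell_norm p y \<le> r \<longleftrightarrow> (\<forall>K. (\<Sum>k<K. \<bar>y k\<bar> powr p) \<le> r powr p)"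
proof -
  have norm_le: "ell_norm p y \<le> r \<longleftrightarrow> (\<Sum>k. \<bar>y k\<bar> powr p) \<le> r powr p"
    if "summable (\<lambda>k. \<bar>y k\<bar> powr p)"
  proof -
    have S: "0 \<le> (\<Sum>k. \<bar>y k\<bar> powr p)" using that by (simp add: suminf_nonneg)
    have "ell_norm p y powr p = (\<Sum>k. \<bar>y k\<bar> powr p)"
      using S assms by (simp add: ell_norm_def powr_powr)
    then show ?thesis
      using powr_mono2[of p "ell_norm p y" r] powr_less_mono2[of p r "ell_norm p y"]
        assms ell_norm_nonneg[of p y] by force
  qed
  show ?thesis
  proof
    assume "y \<in> ell p \<and> ell_norm p y \<le> r"
    then have sm: "summable (\<lambda>k. \<bar>y k\<bar> powr p)" and "(\<Sum>k. \<bar>y k\<bar> powr p) \<le> r powr p"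
      using norm_le by (auto simp: ell_def)
    then show "\<forall>K. (\<Sum>k<K. \<bar>y k\<bar> powr p) \<le> r powr p"
      by (meson finite_lessThan order_trans powr_ge_zero sum_le_suminf)
  next
    assume le: "\<forall>K. (\<Sum>k<K. \<bar>y k\<bar> powr p) \<le> r powr p"
    then have sm: "summable (\<lambda>k. \<bar>y k\<bar> powr p)"
      by (intro bounded_imp_summable[where B = "r powr p"])
         (auto simp flip: lessThan_Suc_atMost simp del: sum.lessThan_Suc)
    then show "y \<in> ell p \<and> ell_norm p y \<le> r"
      using norm_le suminf_le_const[OF sm] le by (simp add: ell_def)
  qed
qed

lemma sum_powr_le_ell_norm:
  assumes "0 < p" "y \<in> ell p" "ell_norm p y \<le> r"
  shows "(\<Sum>k<K. \<bar>y k\<bar> powr p) \<le> r powr p"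
proof -
  have "0 \<le> r" using assms(3) ell_norm_nonneg[of p y] by linarith
  then show ?thesis using ell_norm_le_iff assms by blast
qed

lemma ell_Minkowski:
  assumes p: "1 \<le> p" and x: "x \<in> ell p" and y: "y \<in> ell p"
  shows "x + y \<in> ell p \<and> ell_norm p (x + y) \<le> ell_norm p x + ell_norm p y"
proof -
  have p0: "0 < p" using p by simp
  \<comment> \<open>Radii strictly above the norms are positive even if a norm is 0, so division by
    them is safe; afterwards they shrink to the norms.\<close>
  have *: "x + y \<in> ell p \<and> ell_norm p (x + y) \<le> a + b"
    if a: "ell_norm p x < a" and b: "ell_norm p y < b" for a b
  proof -
    have pos: "0 < a" "0 < b" using a b ell_norm_nonneg[of p x] ell_norm_nonneg[of p y] by linarith+
    define t where "t = b / (a + b)"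
    have t: "0 \<le> t" "t \<le> 1" and t': "1 - t = a / (a + b)"
      using pos by (auto simp: t_def field_simps)
    text \<open>Convexity of the power at the points \<open>\<bar>x k\<bar> / a\<close> and \<open>\<bar>y k\<bar> / b\<close>, with weights
      proportional to \<open>a\<close> and \<open>b\<close>.\<close>
    have conv: "\<bar>(x + y) k\<bar> powr p
        \<le> (a + b) powr p * ((1 - t) * (\<bar>x k\<bar> powr p / a powr p) + t * (\<bar>y k\<bar> powr p / b powr p))"
      for k
    proof -
      have "\<bar>x k\<bar> + \<bar>y k\<bar> = (a + b) * ((1 - t) *\<^sub>R (\<bar>x k\<bar> / a) + t *\<^sub>R (\<bar>y k\<bar> / b))"
        unfolding t' using pos by (simp add: t_def distrib_left)
      then have "\<bar>(x + y) k\<bar> powr p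
          \<le> ((a + b) * ((1 - t) *\<^sub>R (\<bar>x k\<bar> / a) + t *\<^sub>R (\<bar>y k\<bar> / b))) powr p"
        using abs_triangle_ineq[of "x k" "y k"] p by (intro powr_mono2) auto
      also have "\<dots> = (a + b) powr p * ((1 - t) *\<^sub>R (\<bar>x k\<bar> / a) + t *\<^sub>R (\<bar>y k\<bar> / b)) powr p"
        using pos t by (intro powr_mult)
      also have "\<dots> \<le> (a + b) powr p * ((1 - t) * (\<bar>x k\<bar> / a) powr p + t * (\<bar>y k\<bar> / b) powr p)"
        using pos t by (intro mult_left_mono convex_onD[OF powr_convex_nonneg[OF p]]) auto
      finally show ?thesis using pos by (simp add: powr_divide)
    qed
    have "(\<Sum>k<K. \<bar>(x + y) k\<bar> powr p) \<le> (a + b) powr p" for K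
    proof -
      have "(\<Sum>k<K. \<bar>(x + y) k\<bar> powr p) \<le> (\<Sum>k<K. (a + b) powr p *
          ((1 - t) * (\<bar>x k\<bar> powr p / a powr p) + t * (\<bar>y k\<bar> powr p / b powr p)))"
        by (intro sum_mono conv)
      also have "\<dots> = (a + b) powr p * ((1 - t) * ((\<Sum>k<K. \<bar>x k\<bar> powr p) / a powr p)
          + t * ((\<Sum>k<K. \<bar>y k\<bar> powr p) / b powr p))"
        by (simp add: sum.distrib sum_distrib_left sum_divide_distrib distrib_left)
      \<comment> \<open>Each normalised partial sum is at most 1, and the weights add up to
        1.\<close>
      also have "\<dots> \<le> (a + b) powr p * ((1 - t) * 1 + t * 1)"
        using sum_powr_le_ell_norm[OF p0 x less_imp_le[OF a], of K]
          sum_powr_le_ell_norm[OF p0 y less_imp_le[OF b], of K] t pos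
        by (intro mult_left_mono add_mono) auto
      finally show ?thesis by simp
    qed
    then show ?thesis using ell_norm_le_iff[OF p0, of "a + b" "x + y"] pos by simp
  qed
  have "ell_norm p (x + y) \<le> ell_norm p x + ell_norm p y + e" if "0 < e" for e
    using *[of "ell_norm p x + e / 2" "ell_norm p y + e / 2"] that by simp
  then show ?thesis
    using *[of "ell_norm p x + 1" "ell_norm p y + 1"] field_le_epsilon by auto
qed

lemma BK_space_ell:
  assumes p: "1 \<le> p"
  shows "BK_space (ell p) (ell_norm p)"
proof (rule BK_spaceI_closed_balls)
  have p0: "0 < p" using p by simp
  show "0 \<in> ell p" by (simp add: ell_def)
  show "x + y \<in> ell p \<and> ell_norm p (x + y) \<le> ell_norm p x + ell_norm p y"
    if "x \<in> ell p" "y \<in> ell p" for x y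
    using p that by (rule ell_Minkowski)
  show "seq_scale c x \<in> ell p \<and> ell_norm p (seq_scale c x) \<le> \<bar>c\<bar> * ell_norm p x"
    if "x \<in> ell p" for c x
  proof -
    have "(\<Sum>k<K. \<bar>seq_scale c x k\<bar> powr p) = \<bar>c\<bar> powr p * (\<Sum>k<K. \<bar>x k\<bar> powr p)" for K
      by (simp add: seq_scale_def abs_mult powr_mult sum_distrib_left)
    moreover have "\<bar>c\<bar> powr p * (\<Sum>k<K. \<bar>x k\<bar> powr p) \<le> (\<bar>c\<bar> * ell_norm p x) powr p" for K
      using sum_powr_le_ell_norm[OF p0 that order_refl, of K]
      by (simp add: powr_mult ell_norm_nonneg mult_left_mono)
    ultimately show ?thesis
      using ell_norm_le_iff[OF p0, of "\<bar>c\<bar> * ell_norm p x"] by (simp add: ell_norm_nonneg)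
  qed
  show "\<bar>x k\<bar> \<le> ell_norm p x" if "x \<in> ell p" for x k
  proof -
    have "\<bar>x k\<bar> powr p \<le> (\<Sum>i<Suc k. \<bar>x i\<bar> powr p)"
      by (intro member_le_sum) auto
    also have "\<dots> \<le> ell_norm p x powr p"
      using p0 that order_refl by (rule sum_powr_le_ell_norm)
    finally show ?thesis
      using powr_less_mono2[OF p0 ell_norm_nonneg, of p x "\<bar>x k\<bar>"] by linarith
  qed
  show "x \<in> ell p \<and> ell_norm p x \<le> r"
    if z: "\<And>n::nat. z n \<in> ell p \<and> ell_norm p (z n) \<le> r" and lim: "\<And>k. (\<lambda>n. z n k) \<longlonglongrightarrow> x k"
    for z x r
  proof -
    have "0 \<le> r" using z[of 0] ell_norm_nonneg[of p "z 0"] by linarith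
    moreover have "(\<Sum>k<K. \<bar>x k\<bar> powr p) \<le> r powr p" for K
    proof (rule LIMSEQ_le_const2)
      \<comment> \<open>A limit coordinate may be 0; the power is still continuous there along
        nonnegative bases because \<open>p\<close> is positive.\<close>
      show "(\<lambda>n. \<Sum>k<K. \<bar>z n k\<bar> powr p) \<longlonglongrightarrow> (\<Sum>k<K. \<bar>x k\<bar> powr p)"
        using p0 by (intro tendsto_sum tendsto_powr' tendsto_rabs lim tendsto_const) auto
      show "\<exists>M. \<forall>n\<ge>M. (\<Sum>k<K. \<bar>z n k\<bar> powr p) \<le> r powr p"
        using sum_powr_le_ell_norm[OF p0] z by blast
    qed
    ultimately show ?thesis using ell_norm_le_iff[OF p0] by blast
  qed
qed

text \<open>The real supremum is a least upper bound only for sets bounded above, hence membership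
  is paired with the bound. The balls become coordinatewise conditions, just as the balls of
  \<open>ell p\<close> became conditions on partial sums.\<close>

lemma ell_inf_norm_le_iff:
  "y \<in> ell_inf \<and> ell_inf_norm y \<le> r \<longleftrightarrow> (\<forall>k. \<bar>y k\<bar> \<le> r)"
proof
  assume y: "y \<in> ell_inf \<and> ell_inf_norm y \<le> r"
  then obtain B where "\<forall>k. \<bar>y k\<bar> \<le> B"
    by (auto simp: ell_inf_def bounded_iff)
  then have "bdd_above (range (\<lambda>k. \<bar>y k\<bar>))" by (auto intro: bdd_aboveI)
  then have "\<bar>y k\<bar> \<le> ell_inf_norm y" for k
    unfolding ell_inf_norm_def by (intro cSUP_upper) auto
  then show "\<forall>k. \<bar>y k\<bar> \<le> r" using y order_trans by blast
next
  assume "\<forall>k. \<bar>y k\<bar> \<le> r"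
  then show "y \<in> ell_inf \<and> ell_inf_norm y \<le> r"
    by (auto simp: ell_inf_def bounded_iff ell_inf_norm_def intro: cSUP_least)
qed

lemma BK_space_ell_inf: "BK_space ell_inf ell_inf_norm"
proof (rule BK_spaceI_closed_balls)
  show coord: "\<bar>x k\<bar> \<le> ell_inf_norm x" if "x \<in> ell_inf" for x k
    using that ell_inf_norm_le_iff by blast
  show "0 \<in> ell_inf" using ell_inf_norm_le_iff[of 0 0] by simp
  show "x + y \<in> ell_inf \<and> ell_inf_norm (x + y) \<le> ell_inf_norm x + ell_inf_norm y"
    if "x \<in> ell_inf" "y \<in> ell_inf" for x y
    unfolding ell_inf_norm_le_iff plus_fun_def
    using coord that by (meson abs_triangle_ineq add_mono order_trans)
  show "seq_scale c x \<in> ell_inf \<and> ell_inf_norm (seq_scale c x) \<le> \<bar>c\<bar> * ell_inf_norm x"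
    if "x \<in> ell_inf" for c x
    unfolding ell_inf_norm_le_iff
    using coord[OF that] by (simp add: seq_scale_def abs_mult mult_left_mono)
  show "x \<in> ell_inf \<and> ell_inf_norm x \<le> r"
    if z: "\<And>n::nat. z n \<in> ell_inf \<and> ell_inf_norm (z n) \<le> r" and lim: "\<And>k. (\<lambda>n. z n k) \<longlonglongrightarrow> x k"
    for z x r
    unfolding ell_inf_norm_le_iff
  proof
    fix k
    show "\<bar>x k\<bar> \<le> r"
      using z unfolding ell_inf_norm_le_iff
      by (intro LIMSEQ_le_const2[OF tendsto_rabs[OF lim]]) auto
  qed
qed

subsection \<open>Domains of triangles\<close>

text \<open>Row \<open>n\<close> is read only up to the diagonal, so any \<open>A\<close> acts as a
  lower triangular matrix, whatever its entries above the diagonal.\<close>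

definition triangle_map :: "(nat \<Rightarrow> nat \<Rightarrow> real) \<Rightarrow> (nat \<Rightarrow> real) \<Rightarrow> nat \<Rightarrow> real" where
  "triangle_map A x n = (\<Sum>k\<le>n. A n k * x k)"

lemma triangle_map_add: "triangle_map A (x + y) = triangle_map A x + triangle_map A y"
  by (simp add: triangle_map_def fun_eq_iff distrib_left sum.distrib)

lemma triangle_map_diff: "triangle_map A (x - y) = triangle_map A x - triangle_map A y"
  by (simp add: triangle_map_def fun_eq_iff right_diff_distrib sum_subtractf)

lemma triangle_map_scale: "triangle_map A (seq_scale c x) = seq_scale c (triangle_map A x)"
  by (simp add: triangle_map_def seq_scale_def fun_eq_iff sum_distrib_left mult.left_commute)

lemma triangle_map_zero: "triangle_map A 0 = 0"
  by (simp add: triangle_map_def fun_eq_iff)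

text \<open>One step of forward substitution. It serves for injectivity and for the continuity of
  the coordinates.\<close>

lemma triangle_map_solve:
  assumes "A n n \<noteq> 0"
  shows "x n = (triangle_map A x n - (\<Sum>k<n. A n k * x k)) / A n n"
  using assms by (simp add: triangle_map_def flip: lessThan_Suc_atMost)

lemma triangle_map_eq_0_iff:
  assumes "\<And>n. A n n \<noteq> 0"
  shows "triangle_map A x = 0 \<longleftrightarrow> x = 0"
proof
  assume 0: "triangle_map A x = 0"
  have "x n = 0" for n
  proof (induction n rule: less_induct)
    case (less n)
    then show ?case by (subst triangle_map_solve[of A n x, OF assms]) (simp add: 0)
  qed
  then show "x = 0" by (simp add: fun_eq_iff)
qed (simp add: triangle_map_zero)

text \<open>Forward substitution, solving for the coordinates in increasing order.\<close>

function triangle_inv :: "(nat \<Rightarrow> nat \<Rightarrow> real) \<Rightarrow> (nat \<Rightarrow> real) \<Rightarrow> nat \<Rightarrow> real" where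
  "triangle_inv A y n = (y n - (\<Sum>k<n. A n k * triangle_inv A y k)) / A n n"
  by pat_completeness auto
termination by (relation "Wellfounded.measure (\<lambda>(A, y, n). n)") auto

text \<open>As a rewrite rule the equation would loop, since its left side matches every recursive
  call.\<close>

declare triangle_inv.simps [simp del]

lemma triangle_map_inv:
  assumes "\<And>n. A n n \<noteq> 0"
  shows "triangle_map A (triangle_inv A y) = y"
proof
  fix n
  show "triangle_map A (triangle_inv A y) n = y n"
    using assms[of n] triangle_inv.simps[of A y n]
    by (simp add: triangle_map_def field_simps flip: lessThan_Suc_atMost)
qed

text \<open>The norm is chosen to make \<open>triangle_map A\<close> an isometry. The nonzero
  diagonal enters three times: injectivity makes the norm definite, surjectivity transports limits
  back for completeness, and forward substitution yields continuous coordinates.\<close>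

theorem BK_space_triangle_domain:
  assumes Y: "BK_space Y M" and A: "\<And>n. A n n \<noteq> 0"
  shows "BK_space {x. triangle_map A x \<in> Y} (\<lambda>x. M (triangle_map A x))"
    (is "BK_space ?X ?N")
proof -
  let ?T = "triangle_map A"
  have subY: "seq.subspace Y" and normY: "is_norm_on Y M"
    and complY: "Metric_space.mcomplete Y (norm_dist Y M)"
    and coordY: "\<And>n. continuous_map (Metric_space.mtopology Y (norm_dist Y M)) euclideanreal (\<lambda>y. y n)"
    using Y by (auto simp: BK_space_def)
  interpret Y: Metric_space Y "norm_dist Y M"
    using Y by (rule BK_space_Metric_space)
  have subX: "seq.subspace ?X"
    using subY by (auto simp: seq_subspace_iff triangle_map_add triangle_map_scale triangle_map_zero)
  have normX: "is_norm_on ?X ?N"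
    using normY
    by (simp add: is_norm_on_def triangle_map_add triangle_map_scale triangle_map_eq_0_iff[OF A])
  interpret X: Metric_space ?X "norm_dist ?X ?N"
    using subX normX by (rule Metric_space_norm_dist)
  \<comment> \<open>True for all \<open>x\<close> and \<open>y\<close>: outside the domain both
    distances take the default value 0.\<close>
  have dist: "norm_dist ?X ?N x y = norm_dist Y M (?T x) (?T y)" for x y
    by (simp add: norm_dist_def triangle_map_diff)
  have "X.mcomplete"
    unfolding X.mcomplete_def
  proof (intro allI impI)
    fix s assume "X.MCauchy s"
    then have s: "?T (s n) \<in> Y" and "Y.MCauchy (\<lambda>n. ?T (s n))" for n
      by (auto simp: X.MCauchy_def Y.MCauchy_def dist)
    then obtain y where y: "limitin Y.mtopology (\<lambda>n. ?T (s n)) y sequentially"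
      using complY by (auto simp: Y.mcomplete_def)
    have "limitin X.mtopology s (triangle_inv A y) sequentially"
      using y unfolding X.limit_metric_sequentially Y.limit_metric_sequentially
      by (simp add: dist triangle_map_inv[OF A])
    then show "\<exists>l. limitin X.mtopology s l sequentially" by blast
  qed
  moreover have "continuous_map X.mtopology euclideanreal (\<lambda>x. x n)" for n
  \<comment> \<open>By forward substitution, coordinate \<open>n\<close> combines a coordinate of
    the image, continuous by isometry, with earlier coordinates, continuous by induction.\<close>
  proof (induction n rule: less_induct)
    case (less n)
    have "continuous_map X.mtopology Y.mtopology ?T"
      unfolding X.metric_continuous_map[OF Y.Metric_space_axioms] by (auto simp: dist)
    then have "continuous_map X.mtopology euclideanreal (\<lambda>x. ?T x n)"
      using continuous_map_compose[OF _ coordY[of n]] by (simp add: o_def)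
    then have "continuous_map X.mtopology euclideanreal
        (\<lambda>x. (?T x n - (\<Sum>k<n. A n k * x k)) / A n n)"
      using less A by (intro continuous_intros) auto
    then show ?case
      by (simp flip: triangle_map_solve[of A n, OF A])
  qed
  ultimately show ?thesis
    unfolding BK_space_def using subX normX by blast
qed

subsection \<open>The lambda-Fibonacci matrix\<close>

lemma fibF_pos: "0 < fibF n"
  by (simp add: fibF_def fib_neq_0_nat)

text \<open>Collecting the coefficient of \<open>x k\<close>, which occurs in the summands \<open>k\<close> and \<open>Suc k\<close> of \<open>E\<close>.\<close>

definition lamF_matrix :: "(nat \<Rightarrow> real) \<Rightarrow> nat \<Rightarrow> nat \<Rightarrow> real" where
  "lamF_matrix lam n k = 1 / lam n *
     ((lam k - prev lam k) * (fibF k / fibF (k + 1))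
      - (if k < n then (lam (k + 1) - lam k) * (fibF (k + 2) / fibF (k + 1)) else 0))"

lemma E_eq_triangle_map: "E lam = triangle_map (lamF_matrix lam)"
proof (intro ext)
  fix x n
  let ?u = "\<lambda>k. (lam k - prev lam k) * (fibF k / fibF (k + 1)) * x k"
  let ?v = "\<lambda>k. (lam (k + 1) - lam k) * (fibF (k + 2) / fibF (k + 1)) * x k"
  \<comment> \<open>The term at 0 vanishes because \<open>prev x 0 = 0\<close>. Reindexing the
    others ends the sum below \<open>n\<close>, which is why the matrix subtracts nothing on its
    diagonal.\<close>
  have shift: "(\<Sum>k\<le>n. (lam k - prev lam k) * (fibF (k + 1) / fibF k) * prev x k) = (\<Sum>k<n. ?v k)"
    by (simp add: sum.atMost_shift prev_def)
  have cut: "(\<Sum>k\<le>n. if k < n then ?v k else 0) = (\<Sum>k<n. ?v k)"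
    by (simp flip: lessThan_Suc_atMost)
  have "lamF_matrix lam n k * x k = 1 / lam n * (?u k - (if k < n then ?v k else 0))" for k
    by (simp add: lamF_matrix_def left_diff_distrib)
  then have "triangle_map (lamF_matrix lam) x n
      = 1 / lam n * (\<Sum>k\<le>n. ?u k - (if k < n then ?v k else 0))"
    unfolding triangle_map_def sum_distrib_left by (rule sum.cong[OF refl])
  also have "\<dots> = 1 / lam n * ((\<Sum>k\<le>n. ?u k) - (\<Sum>k<n. ?v k))"
    unfolding sum_subtractf cut ..
  also have "\<dots> = E lam x n"
    unfolding E_def atLeast0AtMost shift[symmetric]
    by (simp add: sum_subtractf right_diff_distrib mult.assoc)
  finally show "E lam x n = triangle_map (lamF_matrix lam) x n" ..
qed

text \<open>The diagonal entry is the increment of \<open>lam\<close> times a positive factor.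
  Strict monotonicity makes the increment positive; at \<open>n = 0\<close> it is
  \<open>lam 0\<close> itself, so positivity of \<open>lam\<close> is used.\<close>

lemma lamF_matrix_diag:
  assumes "\<forall>k. 0 < lam k" "strict_mono lam"
  shows "lamF_matrix lam n n \<noteq> 0"
proof -
  have "prev lam n < lam n"
    using assms by (cases n) (auto simp: prev_def strict_mono_Suc_iff)
  moreover have "lam n \<noteq> 0" "fibF n \<noteq> 0" "fibF (n + 1) \<noteq> 0"
    using assms(1) fibF_pos by (simp_all add: less_imp_neq[symmetric])
  ultimately show ?thesis by (simp add: lamF_matrix_def)
qed

theorem theorem2p1:
  fixes p :: real and lam :: "nat \<Rightarrow> real"
  assumes "1 \<le> p"
    and "\<forall>k. 0 < lam k"
    and "strict_mono lam"
    and "filterlim lam at_top sequentially"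
  shows "BK_space (ell_lamF p lam) (\<lambda>x. ell_norm p (E lam x)) \<and>
         BK_space (ell_inf_lamF lam) (\<lambda>x. ell_inf_norm (E lam x))"
proof -
  \<comment> \<open>Stated for an arbitrary BK-space \<open>Y\<close>, so that it applies to both
    classical spaces.\<close>
  have "BK_space {x. E lam x \<in> Y} (\<lambda>x. M (E lam x))" if "BK_space Y M" for Y M
    unfolding E_eq_triangle_map
    using that lamF_matrix_diag[OF assms(2,3)] by (rule BK_space_triangle_domain)
  then show ?thesis
    using BK_space_ell[OF assms(1)] BK_space_ell_inf
    by (simp add: ell_lamF_def ell_inf_lamF_def)
qed

end
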